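(* Let $T\subset\mathbb R^3\setminus\{\mathcal O\}$ be a (nonempty) set of points that satisfies Hypothesis H1. Then $T$ does not satisfy Hypothesis H2.
   Context: $\mathcal O$ is the origin of $\mathbb R^3$ and $k_x=x/|x|$. For $T$ put $c=\min_{x,y\in T}\langle k_x,k_y\rangle$, $\ell=\min_{x\in T}|x|$, $L=\max_{x\in T}|x|$. Hypothesis H1: $T$ is a compact subset of $\mathbb R^3$ contained in a half space of $\mathbb R^3$, $\ell>0$, and $2\ell c>L$. Under H1 define $$\epsilon_0=\frac{\ell+\sqrt{\ell^2-2L\ell c+L^2}}{2\ell c-L}.$$ Hypothesis H2 is the conjunction of the following conditions: (1) the inequalities $$2\ell-L\epsilon_0>0$$ and $$\epsilon_0>\frac{\ell\epsilon_0+\sqrt{\ell^2\epsilon_0^2-2\ell L\epsilon_0+L^2\epsilon_0^2}}{2\ell-L\epsilon_0}$$ hold, together with one further inequality $P(T)$; (2) for some number $\gamma'>0$ a further condition $Q(T,\gamma')$ is satisfied. Here $P$ and $Q$ are conditions from earlier work (Kochengin, Oliker, Tempeski); for the present statement they may be taken to be arbitrary predicates. *)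

theory Defs
  imports "HOL-Analysis.Analysis"
begin

definition dir :: "real^3 \<Rightarrow> real^3" where
  "dir x = x /\<^sub>R norm x"

text \<open>The minima and maximum are written as infima and supremum; for nonempty compact
  \<open>T\<close> avoiding the origin they are attained, see the three lemmas below.\<close>

definition min_cos :: "(real^3) set \<Rightarrow> real" where
  "min_cos T = (INF (x, y)\<in>T \<times> T. inner (dir x) (dir y))"

definition min_norm :: "(real^3) set \<Rightarrow> real" where
  "min_norm T = (INF x\<in>T. norm x)"

definition max_norm :: "(real^3) set \<Rightarrow> real" where
  "max_norm T = (SUP x\<in>T. norm x)"

lemma min_cos_attained:
  assumes "compact T" "T \<noteq> {}" "0 \<notin> T"
  shows "\<exists>x\<in>T. \<exists>y\<in>T. min_cos T = inner (dir x) (dir y) \<and>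
    (\<forall>u\<in>T. \<forall>v\<in>T. inner (dir x) (dir y) \<le> inner (dir u) (dir v))"
proof -
  let ?f = "\<lambda>p. inner (dir (fst p)) (dir (snd p))"
  have "continuous_on (T \<times> T) ?f"
    unfolding dir_def using assms(3) by (intro continuous_intros) auto
  moreover have "compact (T \<times> T)" "T \<times> T \<noteq> {}"
    using assms by (auto simp: compact_Times)
  ultimately obtain p where p: "p \<in> T \<times> T" "\<And>q. q \<in> T \<times> T \<Longrightarrow> ?f p \<le> ?f q"
    using continuous_attains_inf[of "T \<times> T" ?f] by blast
  have "min_cos T = (INF q\<in>T \<times> T. ?f q)"
    by (simp add: min_cos_def case_prod_unfold)
  also have "\<dots> = ?f p"
    using p by (intro cInf_eq_minimum) auto
  finally show ?thesis
    using p by force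
qed

lemma min_norm_attained:
  assumes "compact T" "T \<noteq> {}"
  shows "\<exists>x\<in>T. min_norm T = norm x \<and> (\<forall>y\<in>T. norm x \<le> norm y)"
proof -
  obtain x where x: "x \<in> T" "\<forall>y\<in>T. norm x \<le> norm y"
    using continuous_attains_inf[OF assms, of norm] by (auto intro: continuous_intros)
  then have "min_norm T = norm x"
    unfolding min_norm_def by (intro cInf_eq_minimum) auto
  with x show ?thesis by blast
qed

lemma max_norm_attained:
  assumes "compact T" "T \<noteq> {}"
  shows "\<exists>x\<in>T. max_norm T = norm x \<and> (\<forall>y\<in>T. norm y \<le> norm x)"
proof -
  obtain x where x: "x \<in> T" "\<forall>y\<in>T. norm y \<le> norm x"
    using continuous_attains_sup[OF assms, of norm] by (auto intro: continuous_intros)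
  then have "max_norm T = norm x"
    unfolding max_norm_def by (intro cSup_eq_maximum) auto
  with x show ?thesis by blast
qed

text \<open>The half space is a closed affine one, whose boundary plane need not contain the
  origin.  A set contained in an open half space, or in one bounded by a plane through the
  origin, satisfies this too, so this is the weakest reading of the condition.\<close>

definition in_half_space :: "(real^3) set \<Rightarrow> bool" where
  "in_half_space T \<longleftrightarrow> (\<exists>a b. a \<noteq> 0 \<and> T \<subseteq> {x. inner a x \<le> b})"

definition H1 :: "(real^3) set \<Rightarrow> bool" where
  "H1 T \<longleftrightarrow> compact T \<and> in_half_space T \<and> min_norm T > 0 \<and>
    2 * min_norm T * min_cos T > max_norm T"

definition eps0 :: "(real^3) set \<Rightarrow> real" where
  "eps0 T = (let l = min_norm T; L = max_norm T; c = min_cos T in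
    (l + sqrt (l\<^sup>2 - 2 * L * l * c + L\<^sup>2)) / (2 * l * c - L))"

text \<open>\<open>P\<close> and \<open>Q\<close> stand for the further conditions of the hypothesis; they are parameters.
  If \<open>T\<close> is nonempty, avoids the origin and satisfies \<open>H1\<close>, then \<open>min_cos T \<le> 1\<close> and
  \<open>eps0 T \<ge> 1\<close>, so both radicands (here and in \<open>eps0\<close>) are nonnegative, and the value
  of \<open>sqrt\<close> at negative arguments plays no role.\<close>

definition H2 :: "((real^3) set \<Rightarrow> bool) \<Rightarrow> ((real^3) set \<Rightarrow> real \<Rightarrow> bool) \<Rightarrow> (real^3) set \<Rightarrow> bool" where
  "H2 P Q T \<longleftrightarrow>
    (let l = min_norm T; L = max_norm T; e = eps0 T in
      2 * l - L * e > 0 \<and>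
      e > (l * e + sqrt (l\<^sup>2 * e\<^sup>2 - 2 * l * L * e + L\<^sup>2 * e\<^sup>2)) / (2 * l - L * e) \<and>
      P T) \<and>
    (\<exists>\<gamma>'>0. Q T \<gamma>')"

end

theory Submission imports Defs begin

text \<open>Write \<open>l\<close>, \<open>L\<close>, \<open>c\<close>, \<open>e\<close> for the minimal norm, the maximal norm, the minimal cosine
  and \<^term>\<open>eps0 T\<close>.  The two hypotheses put \<open>e\<close> on opposite sides of \<open>1\<close>.

  On one side, \<open>c \<le> 1\<close> and \<open>l \<le> L\<close> bound the denominator of \<open>e\<close> by \<open>2 l - L \<le> l\<close>, while
  its numerator is at least \<open>l\<close>; hence \<open>e \<ge> 1\<close> (\<open>eps0_ge_1\<close>).  On the other side, clearing
  the denominator in the second inequality of \<open>H2\<close> leaves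
  \<open>l e - L e\<^sup>2 > sqrt (l\<^sup>2 e\<^sup>2 - 2 l L e + L\<^sup>2 e\<^sup>2) \<ge> 0\<close>,
  the radicand being nonnegative as soon as \<open>e \<ge> 1\<close>.  Then \<open>L e < l\<close>, and so \<open>e < 1\<close>.\<close>

lemma min_cos_le_1:
  assumes "compact T" "T \<noteq> {}" "0 \<notin> T"
  shows "min_cos T \<le> 1"
proof -
  obtain x y where xy: "x \<in> T" "y \<in> T" and "min_cos T = inner (dir x) (dir y)"
    using min_cos_attained[OF assms] by blast
  moreover have "x \<noteq> 0" "y \<noteq> 0"
    using xy assms(3) by auto
  then have "norm (dir x) = 1" "norm (dir y) = 1"
    by (simp_all add: dir_def)
  ultimately show ?thesis
    using norm_cauchy_schwarz[of "dir x" "dir y"] by simp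
qed

lemma min_norm_le_max_norm:
  assumes "compact T" "T \<noteq> {}"
  shows "min_norm T \<le> max_norm T"
  using min_norm_attained[OF assms] max_norm_attained[OF assms] by force

lemma eps0_ge_1:
  assumes "compact T" "T \<noteq> {}" "0 \<notin> T" "min_norm T > 0"
    and "2 * min_norm T * min_cos T > max_norm T"
  shows "eps0 T \<ge> 1"
proof -
  define l L c where "l = min_norm T" and "L = max_norm T" and "c = min_cos T"
  note defs = l_def L_def c_def
  have l: "0 < l" "l \<le> L" and d: "0 < 2 * l * c - L" and c: "c \<le> 1"
    using assms min_norm_le_max_norm min_cos_le_1 by (auto simp: defs)
  have lc: "l * c \<le> l"
    using l c by simp
  have "L * (l * c) \<le> L * l"
    using l lc by (intro mult_left_mono) auto
  \<comment> \<open>The square root is odd on the reals, so its sign needs that of the radicand,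
    which is at least \<open>(L - l)\<^sup>2\<close>.\<close>
  moreover have "0 \<le> (L - l)\<^sup>2"
    by simp
  ultimately have "0 \<le> l\<^sup>2 - 2 * L * l * c + L\<^sup>2"
    by (simp add: power2_diff algebra_simps)
  then have "0 \<le> sqrt (l\<^sup>2 - 2 * L * l * c + L\<^sup>2)"
    by simp
  moreover have "2 * l * c - L \<le> l"
    using l lc by linarith
  ultimately have "2 * l * c - L \<le> l + sqrt (l\<^sup>2 - 2 * L * l * c + L\<^sup>2)"
    by linarith
  then show ?thesis
    using d by (simp add: eps0_def Let_def defs)
qed

text \<open>The square root can be dropped after clearing the denominator because its radicand is
  nonnegative: for \<open>e \<ge> 1\<close> it is at least \<open>(l - L)\<^sup>2 e\<^sup>2\<close>.\<close>

lemma second_inequality_fails: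
  fixes l L e :: real
  assumes "0 < l" "l \<le> L" "1 \<le> e" "0 < 2 * l - L * e"
  shows "e \<le> (l * e + sqrt (l\<^sup>2 * e\<^sup>2 - 2 * l * L * e + L\<^sup>2 * e\<^sup>2)) / (2 * l - L * e)"
proof -
  have "e \<le> e\<^sup>2"
    using assms by (simp add: power2_eq_square)
  then have "(l * L) * e \<le> (l * L) * e\<^sup>2"
    using assms by (intro mult_left_mono) auto
  moreover have "0 \<le> (l - L)\<^sup>2 * e\<^sup>2"
    by simp
  ultimately have "0 \<le> sqrt (l\<^sup>2 * e\<^sup>2 - 2 * l * L * e + L\<^sup>2 * e\<^sup>2)"
    by (simp add: power2_diff algebra_simps)
  moreover have "l \<le> L * e"
    using assms mult_left_mono[of 1 e L] by linarith
  then have "(2 * l - L * e) * e \<le> l * e"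
    using assms by (intro mult_right_mono) auto
  ultimately have "(2 * l - L * e) * e \<le> l * e + sqrt (l\<^sup>2 * e\<^sup>2 - 2 * l * L * e + L\<^sup>2 * e\<^sup>2)"
    by linarith
  then show ?thesis
    using assms by (simp add: pos_le_divide_eq mult.commute)
qed

theorem theorem8p1:
  fixes T :: "(real^3) set"
    and P :: "(real^3) set \<Rightarrow> bool"
    and Q :: "(real^3) set \<Rightarrow> real \<Rightarrow> bool"
  assumes "T \<subseteq> UNIV - {0}" and "T \<noteq> {}" and "H1 T"
  shows "\<not> H2 P Q T"
proof -
  have T: "compact T" "T \<noteq> {}" "0 \<notin> T" "min_norm T > 0"
      "2 * min_norm T * min_cos T > max_norm T"
    using assms by (auto simp: H1_def)
  show ?thesis
    using second_inequality_fails[OF T(4) min_norm_le_max_norm[OF T(1,2)] eps0_ge_1[OF T]]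
    by (auto simp: H2_def Let_def)
qed

end
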